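(* Let $m,n$ be positive integers, $A\in\mathbb{Z}^{m\times n^2}$, $b\in\mathbb{Z}^m$, $\unlhd\in\{=,\le\}^m$, $s\in\mathbb{R}^n$, and let $X\in\Pi(A,b,\unlhd)$. Let $V$ be the set of vertices of the code polytope $\mathcal{P}(A,b,\unlhd)$. Assume that the codeword $Xs$ is transmitted to a receiver via an AWGN channel, with additive white Gaussian noise of mean $0$ and variance $\sigma^2$ (that is, $y=Xs+z$ is received, where $z\in\mathbb{R}^n$ is the noise vector), and that the receiver uses LP decoding. Then the block error probability $P_{LP}(X)$ is upper bounded by $$P_{LP}(X)\le\sum_{\tilde X\in V\setminus\{X\}}Q\!\left(\frac{\|Xs\|^2-(\tilde Xs)^TXs}{\sigma\,\|\tilde Xs-Xs\|}\right),$$ where $Q(x)=\int_x^\infty\frac{1}{\sqrt{2\pi}}\exp(-t^2/2)\,dt$ is the tail probability of the standard Gaussian distribution.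
   Context: $\Pi_n$ is the set of $n\times n$ permutation matrices, and $B_n$ (the Birkhoff polytope) is the set of $n\times n$ doubly stochastic matrices (non-negative real matrices with all row and column sums 1). $\mathrm{vec}(X)\in\mathbb{R}^{n^2}$ is the row-by-row vectorization of $X$. For $\unlhd=(\unlhd_1,\dots,\unlhd_m)$ with each $\unlhd_i$ either $=$ or $\le$, $u\unlhd v$ means $u_i\unlhd_i v_i$ for all $i$. Define $\Pi(A,b,\unlhd)=\{X\in\Pi_n : A\,\mathrm{vec}(X)\unlhd b\}$ and the code polytope $\mathcal{P}(A,b,\unlhd)=B_n\cap\{X\in\mathbb{R}^{n\times n} : A\,\mathrm{vec}(X)\unlhd b\}$; its vertices may include non-integral matrices. The code is $\{Xs : X\in\Pi(A,b,\unlhd)\}$. LP decoding: given $y\in\mathbb{R}^n$, let $X^*$ be the solution of the linear program maximizing $\operatorname{trace}(C^TX)$ with $C=ys^T$ (equivalently, maximizing $y^TXs$) over $X\in\mathcal{P}(A,b,\unlhd)$; output $X^*s$ if $X^*$ is integral, and otherwise declare decoding failure. $\|\cdot\|$ is the Euclidean norm.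
   Formalization: If a vertex X̃ ≠ X has X̃s = Xs (possible only when s has repeated entries), the summand Q(0/0) is undefined; it is taken to be 1 there, since the value Q(0) = 1/2 would make the bound false. *)

theory Defs
  imports "HOL-Probability.Probability"
begin

definition permutation_matrices :: "(real ^ 'n ^ 'n) set" where
  "permutation_matrices = {X. \<exists>p. p permutes UNIV \<and> X = (\<chi> i j. if j = p i then 1 else 0)}"

definition birkhoff :: "(real ^ 'n ^ 'n) set" where
  "birkhoff = {X. (\<forall>i j. 0 \<le> X $ i $ j) \<and> (\<forall>i. (\<Sum>j\<in>UNIV. X $ i $ j) = 1)
                   \<and> (\<forall>j. (\<Sum>i\<in>UNIV. X $ i $ j) = 1)}"

text \<open>The coordinates of the vectorization (and the columns of a constraint matrix \<open>A\<close>) are labelled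
  by pairs (row, column), so that there are \<open>CARD('n)\<^sup>2\<close> of them. Row-by-row enumeration of
  these labels would only be a renaming of the column indices of \<open>A\<close>.\<close>

definition vectorize :: "real ^ 'n ^ 'n \<Rightarrow> real ^ ('n \<times> 'n)" where
  "vectorize X = (\<chi> ij. X $ fst ij $ snd ij)"

datatype cmp = Equal | LessEqual

fun cmp_holds :: "cmp \<Rightarrow> real \<Rightarrow> real \<Rightarrow> bool" where
  "cmp_holds Equal u v \<longleftrightarrow> u = v"
| "cmp_holds LessEqual u v \<longleftrightarrow> u \<le> v"

definition satisfies_constraints ::
  "int ^ ('n \<times> 'n) ^ 'm \<Rightarrow> int ^ 'm \<Rightarrow> cmp ^ 'm \<Rightarrow> real ^ 'n ^ 'n \<Rightarrow> bool" where
  "satisfies_constraints A b R X \<longleftrightarrow>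
     (\<forall>k. cmp_holds (R $ k) ((map_matrix real_of_int A *v vectorize X) $ k) (real_of_int (b $ k)))"

definition code_matrices ::
  "int ^ ('n \<times> 'n) ^ 'm \<Rightarrow> int ^ 'm \<Rightarrow> cmp ^ 'm \<Rightarrow> (real ^ 'n ^ 'n) set" where
  "code_matrices A b R = {X \<in> permutation_matrices. satisfies_constraints A b R X}"

definition code_polytope ::
  "int ^ ('n \<times> 'n) ^ 'm \<Rightarrow> int ^ 'm \<Rightarrow> cmp ^ 'm \<Rightarrow> (real ^ 'n ^ 'n) set" where
  "code_polytope A b R = birkhoff \<inter> {X. satisfies_constraints A b R X}"

definition vertices :: "'a::real_vector set \<Rightarrow> 'a set" where
  "vertices P = {X. X extreme_point_of P}"

definition integral_matrix :: "real ^ 'n ^ 'n \<Rightarrow> bool" where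
  "integral_matrix X \<longleftrightarrow> (\<forall>i j. X $ i $ j \<in> \<int>)"

definition outer_product :: "real ^ 'n \<Rightarrow> real ^ 'n \<Rightarrow> real ^ 'n ^ 'n" where
  "outer_product y s = (\<chi> i j. y $ i * s $ j)"

definition lp_objective :: "real ^ 'n \<Rightarrow> real ^ 'n \<Rightarrow> real ^ 'n ^ 'n \<Rightarrow> real" where
  "lp_objective s y X = trace (transpose (outer_product y s) ** X)"

definition lp_solution :: "(real ^ 'n ^ 'n) set \<Rightarrow> real ^ 'n \<Rightarrow> real ^ 'n \<Rightarrow> real ^ 'n ^ 'n \<Rightarrow> bool" where
  "lp_solution P s y X \<longleftrightarrow> X \<in> P \<and> (\<forall>Y\<in>P. lp_objective s y Y \<le> lp_objective s y X)"

text \<open>An LP solver \<open>S\<close> maps each received word to an optimal solution. If several solutions are optimal,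
  any of them may be chosen; measurability makes decoding failure and decoding error events.\<close>

definition lp_solver :: "(real ^ 'n ^ 'n) set \<Rightarrow> real ^ 'n \<Rightarrow> (real ^ 'n \<Rightarrow> real ^ 'n ^ 'n) \<Rightarrow> bool" where
  "lp_solver P s S \<longleftrightarrow> S \<in> borel_measurable borel \<and> (\<forall>y. lp_solution P s y (S y))"

text \<open>\<open>None\<close> is a declared decoding failure.\<close>

definition lp_decode :: "(real ^ 'n \<Rightarrow> real ^ 'n ^ 'n) \<Rightarrow> real ^ 'n \<Rightarrow> real ^ 'n \<Rightarrow> (real ^ 'n) option" where
  "lp_decode S s y = (if integral_matrix (S y) then Some (S y *v s) else None)"

definition awgn :: "'w measure \<Rightarrow> real \<Rightarrow> ('w \<Rightarrow> real ^ 'n) \<Rightarrow> bool" where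
  "awgn M \<sigma> z \<longleftrightarrow>
     prob_space.indep_vars M (\<lambda>_. borel) (\<lambda>i \<omega>. z \<omega> $ i) UNIV \<and>
     (\<forall>i. distributed M lborel (\<lambda>\<omega>. z \<omega> $ i) (\<lambda>t. ennreal (normal_density 0 \<sigma> t)))"

definition block_error_probability ::
  "'w measure \<Rightarrow> ('w \<Rightarrow> real ^ 'n) \<Rightarrow> (real ^ 'n \<Rightarrow> real ^ 'n ^ 'n) \<Rightarrow> real ^ 'n \<Rightarrow> real ^ 'n ^ 'n \<Rightarrow> real" where
  "block_error_probability M z S s X =
     measure M {\<omega> \<in> space M. lp_decode S s (X *v s + z \<omega>) \<noteq> Some (X *v s)}"

definition gauss_Q :: "real \<Rightarrow> real" where
  "gauss_Q x = (LBINT t:{x..}. 1 / sqrt (2 * pi) * exp (- (t\<^sup>2) / 2))"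

text \<open>The bound on the probability that the LP objective of \<open>Y\<close> is at least that of the transmitted
  \<open>X\<close>. If \<open>Y *v s = X *v s\<close>, the argument of \<open>gauss_Q\<close> is the undefined quotient 0/0 (which
  HOL would evaluate to 0, giving 1/2), but the two objectives agree for every received word, so
  the value is set to 1. This can only occur when \<open>s\<close> has repeated entries.\<close>

definition pairwise_error_bound ::
  "real \<Rightarrow> real ^ 'n \<Rightarrow> real ^ 'n ^ 'n \<Rightarrow> real ^ 'n ^ 'n \<Rightarrow> real" where
  "pairwise_error_bound \<sigma> s X Y =
     (if Y *v s = X *v s then 1
      else gauss_Q (((norm (X *v s))\<^sup>2 - (Y *v s) \<bullet> (X *v s)) / (\<sigma> * norm (Y *v s - X *v s))))"

end

theory Submission
  imports Defs
begin

text \<open>If the decoder does not output the codeword, the LP solution differs from the transmitted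
  matrix, so by Krein--Milman the face of optimal solutions has an extreme point other than that
  matrix. This is a vertex of the code polytope whose objective is at least that of the transmitted
  matrix. For a fixed vertex, this event says that a centred Gaussian (a linear functional of the
  noise) exceeds a threshold; a union bound over the finitely many vertices concludes.\<close>

section \<open>Polyhedrality and compactness of the code polytope\<close>

lemma polyhedron_linear_le:
  fixes f :: "'a::euclidean_space \<Rightarrow> real"
  assumes "linear f"
  shows "polyhedron {x. f x \<le> c}"
proof -
  \<comment> \<open>A linear functional is the inner product with a fixed vector, here
    \<open>adjoint f 1\<close>; this exhibits the set as a half-space.\<close>
  have "{x. f x \<le> c} = {x. adjoint f 1 \<bullet> x \<le> c}"
    using adjoint_works[OF assms, of _ 1] by (simp add: inner_commute)
  then show ?thesis
    by (simp add: polyhedron_halfspace_le)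
qed

lemma polyhedron_linear_eq:
  fixes f :: "'a::euclidean_space \<Rightarrow> real"
  assumes "linear f"
  shows "polyhedron {x. f x = c}"
proof -
  have "{x. f x = c} = {x. adjoint f 1 \<bullet> x = c}"
    using adjoint_works[OF assms, of _ 1] by (simp add: inner_commute)
  then show ?thesis
    by (simp add: polyhedron_hyperplane)
qed

lemma polyhedron_Collect_all:
  fixes P :: "'i::finite \<Rightarrow> 'a::euclidean_space \<Rightarrow> bool"
  assumes "\<And>i. polyhedron {x. P i x}"
  shows "polyhedron {x. \<forall>i. P i x}"
proof -
  have "{x. \<forall>i. P i x} = (\<Inter>i. {x. P i x})"
    by auto
  then show ?thesis
    using assms by (auto intro!: polyhedron_Inter)
qed

lemma polyhedron_Collect_conj:
  assumes "polyhedron {x. P x}" "polyhedron {x. Q x}"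
  shows "polyhedron {x. P x \<and> Q x}"
  using polyhedron_Int[OF assms] by (simp add: Collect_conj_eq)

lemma polyhedron_birkhoff: "polyhedron (birkhoff :: (real ^ 'n::finite ^ 'n) set)"
proof -
  have "polyhedron {X :: real ^ 'n ^ 'n. 0 \<le> X $ i $ j}" for i j
    using polyhedron_linear_le[of "\<lambda>X :: real ^ 'n ^ 'n. - X $ i $ j" 0]
    by (simp add: linear_iff)
  moreover have "polyhedron {X :: real ^ 'n ^ 'n. (\<Sum>j\<in>UNIV. X $ i $ j) = 1}" for i
    by (rule polyhedron_linear_eq) (simp add: linear_iff sum.distrib sum_distrib_left)
  moreover have "polyhedron {X :: real ^ 'n ^ 'n. (\<Sum>i\<in>UNIV. X $ i $ j) = 1}" for j
    by (rule polyhedron_linear_eq) (simp add: linear_iff sum.distrib sum_distrib_left)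
  ultimately show ?thesis
    unfolding birkhoff_def
    by (intro polyhedron_Collect_conj polyhedron_Collect_all)
qed

lemma polyhedron_satisfies_constraints:
  fixes A :: "int ^ ('n::finite \<times> 'n) ^ 'm::finite"
  shows "polyhedron {X. satisfies_constraints A b R X}"
proof -
  have lin: "linear (\<lambda>X :: real ^ 'n ^ 'n. (map_matrix real_of_int A *v vectorize X) $ k)" for k
    by (simp add: linear_iff matrix_vector_mult_def vectorize_def sum.distrib sum_distrib_left
        algebra_simps)
  have "polyhedron {X :: real ^ 'n ^ 'n.
      cmp_holds (R $ k) ((map_matrix real_of_int A *v vectorize X) $ k) (real_of_int (b $ k))}" for k
    by (cases "R $ k") (auto intro: polyhedron_linear_eq polyhedron_linear_le lin)
  then show ?thesis
    unfolding satisfies_constraints_def by (intro polyhedron_Collect_all)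
qed

text \<open>Polyhedrality is what makes the vertex set finite, so that the union bound is a finite
  sum; it also supplies convexity and closedness.\<close>

lemma polyhedron_code_polytope: "polyhedron (code_polytope A b R)"
  unfolding code_polytope_def
  by (intro polyhedron_Int polyhedron_birkhoff polyhedron_satisfies_constraints)

text \<open>A nonnegative entry is at most its row sum 1, and the norm is at most the sum of the
  absolute values of the entries.\<close>

lemma bounded_birkhoff: "bounded (birkhoff :: (real ^ 'n::finite ^ 'n) set)"
proof -
  have "norm X \<le> (\<Sum>i\<in>(UNIV::'n set). \<Sum>j\<in>(UNIV::'n set). 1)"
    if X: "X \<in> birkhoff" for X :: "real ^ 'n ^ 'n"
  proof -
    have "\<bar>X $ i $ j\<bar> \<le> 1" for i j
    proof -
      have "X $ i $ j \<le> (\<Sum>j\<in>UNIV. X $ i $ j)"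
        using X by (intro member_le_sum) (auto simp: birkhoff_def)
      then show ?thesis
        using X by (auto simp: birkhoff_def)
    qed
    then have "norm (X $ i) \<le> (\<Sum>j\<in>(UNIV::'n set). 1)" for i
      by (intro order_trans[OF norm_le_l1_cart] sum_mono) auto
    then show ?thesis
      unfolding norm_vec_def[of X]
      by (intro order_trans[OF L2_set_le_sum] sum_mono) auto
  qed
  then show ?thesis
    by (auto simp: bounded_iff)
qed

lemma compact_code_polytope: "compact (code_polytope A b R)"
  using bounded_birkhoff bounded_Int polyhedron_code_polytope[of A b R]
  unfolding code_polytope_def by (auto simp: compact_eq_bounded_closed polyhedron_imp_closed)

section \<open>Permutation matrices in the code polytope\<close>

lemma code_matrices_subset_code_polytope: "code_matrices A b R \<subseteq> code_polytope A b R"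
proof -
  have "X \<in> birkhoff" if perm: "X \<in> permutation_matrices" for X :: "real ^ 'n ^ 'n"
  proof -
    obtain p where p: "p permutes UNIV" and X: "X = (\<chi> i j. if j = p i then 1 else 0)"
      using perm by (auto simp: permutation_matrices_def)
    \<comment> \<open>The definition displays the single one of each row; solving for the row index
      displays the single one of each column, so that the column sums collapse as well.\<close>
    have "j = p i \<longleftrightarrow> i = inv p j" for i j
      using permutes_inverses[OF p] by metis
    then have "(\<Sum>i\<in>UNIV. X $ i $ j) = (\<Sum>i\<in>UNIV. if i = inv p j then 1 else 0)" for j
      by (simp add: X)
    then show ?thesis
      by (auto simp: birkhoff_def) (auto simp: X)
  qed
  then show ?thesis
    by (auto simp: code_matrices_def code_polytope_def)
qed

lemma integral_matrix_permutation: "X \<in> permutation_matrices \<Longrightarrow> integral_matrix X"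
  by (auto simp: permutation_matrices_def integral_matrix_def)

section \<open>The LP objective and its optimal face\<close>

lemma lp_objective_eq_inner_outer: "lp_objective s y X = outer_product y s \<bullet> X"
  unfolding lp_objective_def trace_def matrix_matrix_mult_def inner_vec_def
  by (simp add: transpose_def) (rule sum.swap)

text \<open>The matrix enters only through its word \<open>X *v s\<close>, and \<open>y\<close>
  enters linearly, so the contribution of the noise can be split off.\<close>

lemma lp_objective_eq: "lp_objective s y X = (X *v s) \<bullet> y"
  unfolding lp_objective_eq_inner_outer inner_vec_def outer_product_def matrix_vector_mult_def
  by (simp add: sum_distrib_left sum_distrib_right mult_ac)

text \<open>The maximiser \<open>x\<close> need not be extreme, and \<open>u\<close> may be optimal
  too. The extreme points of the optimal face are extreme in \<open>P\<close>, and they cannot all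
  equal \<open>u\<close> because they generate \<open>x\<close>.\<close>

lemma other_optimal_extreme_point:
  fixes P :: "'a::euclidean_space set"
  assumes "compact P" "convex P" "x \<in> P" "x \<noteq> u" and max: "\<And>v. v \<in> P \<Longrightarrow> c \<bullet> v \<le> c \<bullet> x"
  obtains v where "v extreme_point_of P" "v \<noteq> u" "c \<bullet> v = c \<bullet> x"
proof -
  define F where "F = P \<inter> {v. c \<bullet> v = c \<bullet> x}"
  have face: "F face_of P"
    unfolding F_def using assms by (intro face_of_Int_supporting_hyperplane_le) auto
  have "F = convex hull {v. v extreme_point_of F}"
    using face assms face_of_imp_compact face_of_imp_convex by (intro Krein_Milman_Minkowski) blast+
  moreover have "x \<in> F"
    using assms by (auto simp: F_def)
  \<comment> \<open>The hull of a subset of \<open>{u}\<close>, the empty one included, lies in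
    \<open>{u}\<close> and so misses \<open>x\<close>.\<close>
  ultimately have "\<not> {v. v extreme_point_of F} \<subseteq> {u}"
    using hull_mono[of "{v. v extreme_point_of F}" "{u}" convex] \<open>x \<noteq> u\<close> by auto
  then obtain v where "v extreme_point_of F" "v \<noteq> u"
    by auto
  then show ?thesis
    using that extreme_point_of_face[OF face] by (auto simp: F_def)
qed

section \<open>Gaussian noise and its tail probabilities\<close>

lemma (in prob_space) inner_awgn_normal:
  fixes z :: "'a \<Rightarrow> real ^ 'n::finite"
  assumes "awgn M \<sigma> z" "\<sigma> > 0" "w \<noteq> 0"
  shows "distributed M lborel (\<lambda>\<omega>. w \<bullet> z \<omega>) (normal_density 0 (\<sigma> * norm w))"
proof -
  \<comment> \<open>A vanishing coefficient would give a constant summand, which has no normal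
    density; the sum is therefore taken over the support of \<open>w\<close>, which is
    nonempty.\<close>
  define I where "I = {i. w $ i \<noteq> 0}"
  have "I \<noteq> {}"
    using \<open>w \<noteq> 0\<close> by (auto simp: I_def vec_eq_iff)
  have "indep_vars (\<lambda>_. borel) (\<lambda>i \<omega>. z \<omega> $ i) I"
    using assms(1) by (auto simp: awgn_def intro: indep_vars_subset)
  then have indep: "indep_vars (\<lambda>_. borel) (\<lambda>i \<omega>. w $ i * z \<omega> $ i) I"
    by (rule indep_vars_compose2) auto
  have normal: "distributed M lborel (\<lambda>\<omega>. w $ i * z \<omega> $ i) (normal_density 0 (\<bar>w $ i\<bar> * \<sigma>))"
    if "i \<in> I" for i
    using normal_density_affine[of "\<lambda>\<omega>. z \<omega> $ i" 0 \<sigma> "w $ i" 0] assms that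
    by (auto simp: awgn_def I_def)
  have "distributed M lborel (\<lambda>\<omega>. \<Sum>i\<in>I. w $ i * z \<omega> $ i)
      (normal_density (\<Sum>i\<in>I. 0) (sqrt (\<Sum>i\<in>I. (\<bar>w $ i\<bar> * \<sigma>)\<^sup>2)))"
    using \<open>I \<noteq> {}\<close> indep normal \<open>\<sigma> > 0\<close>
    by (intro sum_indep_normal) (auto simp: I_def)
  moreover have "(\<Sum>i\<in>I. w $ i * z \<omega> $ i) = w \<bullet> z \<omega>" for \<omega>
    unfolding inner_vec_def by (simp, rule sum.mono_neutral_left) (auto simp: I_def)
  moreover have "sqrt (\<Sum>i\<in>I. (\<bar>w $ i\<bar> * \<sigma>)\<^sup>2) = \<sigma> * norm w"
  proof -
    have "(\<Sum>i\<in>I. (\<bar>w $ i\<bar> * \<sigma>)\<^sup>2) = (\<Sum>i\<in>UNIV. (w $ i)\<^sup>2) * \<sigma>\<^sup>2"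
      by (subst sum_distrib_right, rule sum.mono_neutral_cong_left)
        (auto simp: I_def power_mult_distrib)
    then show ?thesis
      using \<open>\<sigma> > 0\<close> by (simp add: norm_vec_def L2_set_def real_sqrt_mult)
  qed
  ultimately show ?thesis
    by simp
qed

lemma gauss_Q_eq: "gauss_Q x = (LINT t|lborel. std_normal_density t * indicator {x..} t)"
  by (simp add: gauss_Q_def set_lebesgue_integral_def std_normal_density_def mult_ac)

lemma gauss_Q_nonneg: "0 \<le> gauss_Q x"
  unfolding gauss_Q_eq by (intro integral_nonneg_AE) auto

lemma (in prob_space) std_normal_tail:
  assumes "distributed M lborel Z std_normal_density"
  shows "prob {\<omega> \<in> space M. x \<le> Z \<omega>} = gauss_Q x"
proof -
  have "emeasure M (Z -` {x..} \<inter> space M)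
      = (\<integral>\<^sup>+t. ennreal (std_normal_density t) * indicator {x..} t \<partial>lborel)"
    using assms by (rule distributed_emeasure) simp
  also have "\<dots> = (\<integral>\<^sup>+t. ennreal (std_normal_density t * indicator {x..} t) \<partial>lborel)"
    by (intro nn_integral_cong) (auto split: split_indicator)
  also have "\<dots> = ennreal (gauss_Q x)"
    unfolding gauss_Q_eq
    by (intro nn_integral_eq_integral integrable_real_mult_indicator) auto
  finally have "prob (Z -` {x..} \<inter> space M) = gauss_Q x"
    using gauss_Q_nonneg by (simp add: measure_def)
  moreover have "Z -` {x..} \<inter> space M = {\<omega> \<in> space M. x \<le> Z \<omega>}"
    by auto
  ultimately show ?thesis
    by simp
qed

lemma (in prob_space) normal_tail:
  assumes "distributed M lborel W (normal_density 0 \<tau>)" "\<tau> > 0"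
  shows "prob {\<omega> \<in> space M. x \<le> W \<omega>} = gauss_Q (x / \<tau>)"
proof -
  have "distributed M lborel (\<lambda>\<omega>. W \<omega> / \<tau>) std_normal_density"
    using normal_standard_normal_convert[of \<tau> W 0] assms by simp
  from std_normal_tail[OF this, of "x / \<tau>"] show ?thesis
    using \<open>\<tau> > 0\<close> by (simp add: divide_le_cancel)
qed

section \<open>Pairwise errors and the union bound\<close>

lemma (in prob_space) pairwise_error:
  fixes z :: "'a \<Rightarrow> real ^ 'n::finite"
  assumes "awgn M \<sigma> z" "\<sigma> > 0"
  shows "prob {\<omega> \<in> space M. lp_objective s (X *v s + z \<omega>) X \<le> lp_objective s (X *v s + z \<omega>) Y}
    \<le> pairwise_error_bound \<sigma> s X Y"
proof (cases "Y *v s = X *v s")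
  case True
  \<comment> \<open>Here the bound is 1 by convention, which dominates every probability.\<close>
  then show ?thesis
    by (simp add: pairwise_error_bound_def)
next
  case False
  define w where "w = Y *v s - X *v s"
  \<comment> \<open>Separating signal from noise leaves the numerator of the \<open>gauss_Q\<close>
    argument as threshold for \<open>w \<bullet> z \<omega>\<close>, whose standard deviation
    \<open>\<sigma> * norm w\<close> is the denominator.\<close>
  have "lp_objective s (X *v s + z \<omega>) X \<le> lp_objective s (X *v s + z \<omega>) Y
      \<longleftrightarrow> (norm (X *v s))\<^sup>2 - (Y *v s) \<bullet> (X *v s) \<le> w \<bullet> z \<omega>" for \<omega>
    by (auto simp: lp_objective_eq w_def inner_add_right inner_diff_left power2_norm_eq_inner)
  moreover have "w \<noteq> 0"
    using False by (simp add: w_def)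
  ultimately show ?thesis
    using normal_tail[OF inner_awgn_normal[OF assms \<open>w \<noteq> 0\<close>]] False assms(2)
    by (simp add: pairwise_error_bound_def w_def)
qed

theorem lemma1:
  fixes A :: "int ^ ('n::finite \<times> 'n) ^ 'm::finite" and b :: "int ^ 'm" and R :: "cmp ^ 'm"
    and s :: "real ^ 'n" and X :: "real ^ 'n ^ 'n"
    and M :: "'w measure" and z :: "'w \<Rightarrow> real ^ 'n" and \<sigma> :: real
    and S :: "real ^ 'n \<Rightarrow> real ^ 'n ^ 'n"
  assumes "X \<in> code_matrices A b R"
    and "prob_space M" and "\<sigma> > 0" and "awgn M \<sigma> z"
    and "lp_solver (code_polytope A b R) s S"
  shows "block_error_probability M z S s X
    \<le> (\<Sum>Y\<in>vertices (code_polytope A b R) - {X}. pairwise_error_bound \<sigma> s X Y)"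
proof -
  interpret prob_space M by fact
  define P where "P = code_polytope A b R"
  define V where "V = vertices P - {X}"
  define y where "y \<omega> = X *v s + z \<omega>" for \<omega>
  define E where "E Y = {\<omega> \<in> space M. lp_objective s (y \<omega>) X \<le> lp_objective s (y \<omega>) Y}" for Y
  have "finite V"
    using finite_polyhedron_extreme_points[OF polyhedron_code_polytope]
    by (simp add: V_def P_def vertices_def)
  \<comment> \<open>The noise model is stated by coordinates, so the events \<open>E Y\<close> are
    shown measurable by expanding the inner products.\<close>
  have [measurable]: "(\<lambda>\<omega>. z \<omega> $ i) \<in> borel_measurable M" for i
    using assms(4) distributed_measurable by (fastforce simp: awgn_def)
  have meas: "E Y \<in> sets M" for Y
    unfolding E_def lp_objective_eq inner_vec_def y_def by simp
  have "{\<omega> \<in> space M. lp_decode S s (X *v s + z \<omega>) \<noteq> Some (X *v s)} \<subseteq> (\<Union>Y\<in>V. E Y)"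
  proof
    fix \<omega> assume "\<omega> \<in> {\<omega> \<in> space M. lp_decode S s (X *v s + z \<omega>) \<noteq> Some (X *v s)}"
    then have \<omega>: "\<omega> \<in> space M" and "lp_decode S s (y \<omega>) \<noteq> Some (X *v s)"
      by (auto simp: y_def)
    \<comment> \<open>Since \<open>X\<close> is integral, a solver returning \<open>X\<close> would
      make the decoder output \<open>X *v s\<close>; a declared failure and a wrong word are thus
      treated alike.\<close>
    then have "S (y \<omega>) \<noteq> X"
      using integral_matrix_permutation[of X] assms(1)
      by (auto simp: lp_decode_def code_matrices_def)
    moreover have sol: "S (y \<omega>) \<in> P"
      "\<And>Y. Y \<in> P \<Longrightarrow> lp_objective s (y \<omega>) Y \<le> lp_objective s (y \<omega>) (S (y \<omega>))"
      using assms(5) by (auto simp: lp_solver_def lp_solution_def P_def)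
    ultimately obtain Y where "Y extreme_point_of P" "Y \<noteq> X"
      "lp_objective s (y \<omega>) Y = lp_objective s (y \<omega>) (S (y \<omega>))"
      using other_optimal_extreme_point[of P "S (y \<omega>)" X "outer_product (y \<omega>) s"]
        compact_code_polytope[of A b R] polyhedron_imp_convex[OF polyhedron_code_polytope[of A b R]]
      by (auto simp: lp_objective_eq_inner_outer P_def)
    moreover have "X \<in> P"
      using assms(1) code_matrices_subset_code_polytope by (auto simp: P_def)
    \<comment> \<open>As \<open>X\<close> is feasible, the optimal vertex \<open>Y\<close> scores at
      least as well as \<open>X\<close>; ties are covered by the weak inequality in
      \<open>E\<close>.\<close>
    ultimately have "Y \<in> V" "\<omega> \<in> E Y"
      using sol(2)[of X] \<omega> by (auto simp: V_def E_def vertices_def)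
    then show "\<omega> \<in> (\<Union>Y\<in>V. E Y)"
      by blast
  qed
  then have "block_error_probability M z S s X \<le> prob (\<Union>Y\<in>V. E Y)"
    unfolding block_error_probability_def
    using meas \<open>finite V\<close> by (intro finite_measure_mono) auto
  also have "\<dots> \<le> (\<Sum>Y\<in>V. prob (E Y))"
    using meas \<open>finite V\<close> by (intro finite_measure_subadditive_finite) auto
  also have "\<dots> \<le> (\<Sum>Y\<in>V. pairwise_error_bound \<sigma> s X Y)"
    unfolding E_def y_def by (intro sum_mono pairwise_error assms)
  finally show ?thesis
    by (simp add: V_def P_def)
qed

end
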